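(* $\mathrm{DACA}(O(1)) = \mathrm{LT}$.
   Context: A cellular automaton (CA) is $C=(Q,\delta,\Sigma)$ with finite state set $Q$, local rule $\delta\colon Q^3\to Q$, input alphabet $\Sigma\subseteq Q$, and an inactive state $q\in Q\setminus\Sigma$ with $\delta(z_1,z_2,z_3)=q$ iff $z_2=q$; the global map is $\Delta(c)(z)=\delta(c(z-1),c(z),c(z+1))$ on $Q^{\mathbb{Z}}$. For input $w\in\Sigma^+$ the initial configuration $c_0$ has $c_0(i)=w(i)$ for $0\le i<|w|$ and $q$ elsewhere. For $F\subseteq Q\setminus\{q\}$, a configuration $\Delta^\tau(c_0)$ is $F$-final if all its cells are in $F\cup\{q\}$. A decider ACA (DACA) is a CA with nonempty disjoint sets $A,R\subseteq Q\setminus\{q\}$ of accept and reject states such that every input $w\in\Sigma^+$ leads to an $A$-final or an $R$-final configuration; $C$ accepts $w$ if it reaches an $A$-final configuration with no earlier $R$-final configuration, and rejects $w$ if it reaches an $R$-final configuration with no earlier $A$-final one. The time taken on $w$ is the number of steps until the first $A$- or $R$-final configuration. $L(C)$ is the set of accepted words. $\mathrm{DACA}(t)$ is the class of $L(C)$ for DACAs deciding every input $w$ within $t(|w|)$ steps; $\mathrm{DACA}(O(1))$ is the union over constant $t$. For a word $w$ and $k\in\mathbb{N}_0$, $p_k(w)$, $s_k(w)$, $I_k(w)$ denote the prefix, suffix, and set of infixes of length $k$ (with $p_k(w)=s_k(w)=w$, $I_k(w)=\{w\}$ if $k\ge|w|$). $L\subseteq\Sigma^*$ is locally testable if there is $k\in\mathbb{N}_+$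 such that $p_k(w_1)=p_k(w_2)$, $I_k(w_1)=I_k(w_2)$, $s_k(w_1)=s_k(w_2)$ imply $w_1\in L\iff w_2\in L$; $\mathrm{LT}$ is the class of such languages. The empty word is disregarded: all languages are considered as subsets of $\Sigma^+$. *)

theory Defs
  imports Main "HOL-Library.Sublist" "HOL-Library.Infinite_Typeclass"
begin

text \<open>
  State sets and alphabets are finite subsets of a common type of symbols, so that the input
  alphabet is literally a subset of the state set.  The local rule is a total function of which
  only the values on the state set matter.
\<close>

record 'a ca =
  states :: "'a set"
  rule :: "'a \<Rightarrow> 'a \<Rightarrow> 'a \<Rightarrow> 'a"
  alphabet :: "'a set"
  inactive :: 'a

definition is_ca :: "('a, 'b) ca_scheme \<Rightarrow> bool" where
  "is_ca C \<longleftrightarrow>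
     finite (states C) \<and>
     (\<forall>x\<in>states C. \<forall>y\<in>states C. \<forall>z\<in>states C. rule C x y z \<in> states C) \<and>
     alphabet C \<subseteq> states C \<and>
     inactive C \<in> states C - alphabet C \<and>
     (\<forall>x\<in>states C. \<forall>y\<in>states C. \<forall>z\<in>states C. rule C x y z = inactive C \<longleftrightarrow> y = inactive C)"

definition global_map :: "('a, 'b) ca_scheme \<Rightarrow> (int \<Rightarrow> 'a) \<Rightarrow> (int \<Rightarrow> 'a)" where
  "global_map C c = (\<lambda>z. rule C (c (z - 1)) (c z) (c (z + 1)))"

definition initial_config :: "('a, 'b) ca_scheme \<Rightarrow> 'a list \<Rightarrow> (int \<Rightarrow> 'a)" where
  "initial_config C w =
     (\<lambda>i. if 0 \<le> i \<and> i < int (length w) then w ! nat i else inactive C)"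

definition config_at :: "('a, 'b) ca_scheme \<Rightarrow> 'a list \<Rightarrow> nat \<Rightarrow> (int \<Rightarrow> 'a)" where
  "config_at C w \<tau> = (global_map C ^^ \<tau>) (initial_config C w)"

definition final_config :: "('a, 'b) ca_scheme \<Rightarrow> 'a set \<Rightarrow> (int \<Rightarrow> 'a) \<Rightarrow> bool" where
  "final_config C F c \<longleftrightarrow> (\<forall>z. c z \<in> F \<union> {inactive C})"

definition nonempty_words :: "'a set \<Rightarrow> 'a list set" where
  "nonempty_words S = lists S - {[]}"

record 'a daca = "'a ca" +
  accept_states :: "'a set"
  reject_states :: "'a set"

abbreviation accept_final_at :: "('a, 'b) daca_scheme \<Rightarrow> 'a list \<Rightarrow> nat \<Rightarrow> bool" where
  "accept_final_at C w \<tau> \<equiv> final_config C (accept_states C) (config_at C w \<tau>)"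

abbreviation reject_final_at :: "('a, 'b) daca_scheme \<Rightarrow> 'a list \<Rightarrow> nat \<Rightarrow> bool" where
  "reject_final_at C w \<tau> \<equiv> final_config C (reject_states C) (config_at C w \<tau>)"

definition is_daca :: "('a, 'b) daca_scheme \<Rightarrow> bool" where
  "is_daca C \<longleftrightarrow>
     is_ca C \<and>
     accept_states C \<noteq> {} \<and> reject_states C \<noteq> {} \<and>
     accept_states C \<inter> reject_states C = {} \<and>
     accept_states C \<subseteq> states C - {inactive C} \<and>
     reject_states C \<subseteq> states C - {inactive C} \<and>
     (\<forall>w\<in>nonempty_words (alphabet C). \<exists>\<tau>. accept_final_at C w \<tau> \<or> reject_final_at C w \<tau>)"

definition accepts :: "('a, 'b) daca_scheme \<Rightarrow> 'a list \<Rightarrow> bool" where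
  "accepts C w \<longleftrightarrow> (\<exists>\<tau>. accept_final_at C w \<tau> \<and> (\<forall>\<tau>'<\<tau>. \<not> reject_final_at C w \<tau>'))"

definition language :: "('a, 'b) daca_scheme \<Rightarrow> 'a list set" where
  "language C = {w \<in> nonempty_words (alphabet C). accepts C w}"

definition decision_time :: "('a, 'b) daca_scheme \<Rightarrow> 'a list \<Rightarrow> nat" where
  "decision_time C w = (LEAST \<tau>. accept_final_at C w \<tau> \<or> reject_final_at C w \<tau>)"

definition DACA :: "'a set \<Rightarrow> (nat \<Rightarrow> nat) \<Rightarrow> 'a list set set" where
  "DACA \<Sigma> t = {language C | C :: 'a daca.
     is_daca C \<and> alphabet C = \<Sigma> \<and>
     (\<forall>w\<in>nonempty_words \<Sigma>. decision_time C w \<le> t (length w))}"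

definition DACA_const :: "'a set \<Rightarrow> 'a list set set" where
  "DACA_const \<Sigma> = (\<Union>b. DACA \<Sigma> (\<lambda>_. b))"

definition pref :: "nat \<Rightarrow> 'a list \<Rightarrow> 'a list" where
  "pref k w = take k w"

definition suff :: "nat \<Rightarrow> 'a list \<Rightarrow> 'a list" where
  "suff k w = drop (length w - k) w"

definition infixes :: "nat \<Rightarrow> 'a list \<Rightarrow> 'a list set" where
  "infixes k w = (if length w \<le> k then {w} else {u. length u = k \<and> sublist u w})"

definition locally_testable :: "'a set \<Rightarrow> 'a list set \<Rightarrow> bool" where
  "locally_testable \<Sigma> L \<longleftrightarrow>
     L \<subseteq> lists \<Sigma> \<and>
     (\<exists>k>0. \<forall>w\<^sub>1\<in>lists \<Sigma>. \<forall>w\<^sub>2\<in>lists \<Sigma>.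
        pref k w\<^sub>1 = pref k w\<^sub>2 \<and> infixes k w\<^sub>1 = infixes k w\<^sub>2 \<and> suff k w\<^sub>1 = suff k w\<^sub>2
        \<longrightarrow> (w\<^sub>1 \<in> L \<longleftrightarrow> w\<^sub>2 \<in> L))"

definition LT :: "'a set \<Rightarrow> 'a list set set" where
  "LT \<Sigma> = {L. L \<subseteq> nonempty_words \<Sigma> \<and> locally_testable \<Sigma> L}"

end

theory Submission
  imports Defs "HOL-Library.Nat_Bijection"
begin

text \<open>
  The window of radius \<open>r\<close> around a cell of a word is the factor of length \<open>2 r + 1\<close> centred at that
  cell, with \<open>None\<close> for the positions outside the word.  The set of all windows carries the same
  information as prefix, suffix and infixes of bounded length.

  The states at time \<open>t\<close> depend only on the set of windows of radius \<open>t\<close>, and whether a configuration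
  is final depends only on the set of its states; hence constant-time languages are locally testable.

  Conversely, every cell can collect its own window, but no cell learns the set of all windows.
  Therefore the cells vote on all candidate sets \<open>V\<close> one after the other: in the step reserved for \<open>V\<close>
  a cell is in an accept or reject state, according to the status of \<open>V\<close>, iff its window is in \<open>V\<close>.
  The first final configuration belongs to the first \<open>V\<close> that includes the set of windows of the
  word, and since subsets are voted on before their supersets, this \<open>V\<close> is the set of windows itself.
\<close>

section \<open>Windows of padded words\<close>

definition padded :: "'a list \<Rightarrow> int \<Rightarrow> 'a option" where
  "padded w i = (if 0 \<le> i \<and> i < int (length w) then Some (w ! nat i) else None)"

abbreviation cells :: "'a set \<Rightarrow> 'a option set" where
  "cells A \<equiv> insert None (Some ` A)"

definition window :: "nat \<Rightarrow> (int \<Rightarrow> 'a) \<Rightarrow> int \<Rightarrow> 'a list" where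
  "window r c z = map (\<lambda>d. c (z + d)) [- int r..int r]"

definition windows :: "nat \<Rightarrow> 'a list \<Rightarrow> 'a option list set" where
  "windows r w = window r (padded w) ` {0..<int (length w)}"

lemma padded_eq_None_iff: "padded w i = None \<longleftrightarrow> i < 0 \<or> int (length w) \<le> i"
  by (auto simp: padded_def)

lemma padded_in_cells: "w \<in> lists \<Sigma> \<Longrightarrow> padded w i \<in> cells \<Sigma>"
  by (auto simp: padded_def in_lists_conv_set)

lemma padded_map: "padded (map f w) i = map_option f (padded w i)"
  by (simp add: padded_def nat_less_iff)

lemma padded_rev: "padded (rev w) i = padded w (int (length w) - 1 - i)"
proof -
  have "nat (int (length w) - 1 - i) = length w - Suc (nat i)" if "0 \<le> i" "i < int (length w)"
    using that by auto
  then show ?thesis by (auto simp: padded_def rev_nth)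
qed

lemma padded_take_drop:
  "padded (take k (drop n w)) i = (if 0 \<le> i \<and> i < int k then padded w (int n + i) else None)"
  by (auto simp: padded_def nat_add_distrib)

lemma padded_inject: "padded v = padded w \<longleftrightarrow> v = w"
proof
  assume eq: "padded v = padded w"
  show "v = w"
  proof (rule nth_equalityI)
    have "padded v i = None \<longleftrightarrow> padded w i = None" for i by (simp add: eq)
    from this[of "int (length v)"] this[of "int (length w)"] show "length v = length w"
      by (simp add: padded_eq_None_iff)
    fix i assume "i < length v"
    then show "v ! i = w ! i"
      using fun_cong[OF eq, of "int i"] \<open>length v = length w\<close> by (simp add: padded_def)
  qed
qed simp

lemma take_drop_eq_iff_padded_eq:
  "take k (drop m v) = take k (drop n w) \<longleftrightarrow>
    (\<forall>i\<in>{0..<int k}. padded v (int m + i) = padded w (int n + i))"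
  by (auto simp: padded_inject[symmetric] fun_eq_iff padded_take_drop)

lemma length_window [simp]: "length (window r c z) = 2 * r + 1"
  by (simp add: window_def)

lemma nth_window: "i < 2 * r + 1 \<Longrightarrow> window r c z ! i = c (z + int i - int r)"
  using nth_upto[of "- int r" i "int r"] by (simp add: window_def algebra_simps)

lemma set_window_padded:
  assumes "w \<in> lists \<Sigma>"
  shows "set (window r (padded w) z) \<subseteq> cells \<Sigma>"
  unfolding window_def set_map by (rule image_subsetI) (rule padded_in_cells[OF assms])

lemma hd_window: "hd (window r c z) = c (z - int r)"
  using upto_rec1[of "- int r" "int r"] by (simp add: window_def)

lemma last_window: "last (window r c z) = c (z + int r)"
  using upto_rec2[of "- int r" "int r"] by (simp add: window_def)

lemma window_eq_iff:
  "window r c z = window r c' z' \<longleftrightarrow> (\<forall>d. \<bar>d\<bar> \<le> int r \<longrightarrow> c (z + d) = c' (z' + d))"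
proof -
  have "d \<in> {- int r..int r} \<longleftrightarrow> \<bar>d\<bar> \<le> int r" for d by auto
  then show ?thesis unfolding window_def map_eq_conv set_upto by blast
qed

lemma window_Suc:
  "window (Suc r) c z = hd (window r c (z - 1)) # window r c z @ [last (window r c (z + 1))]"
proof -
  have "[- int (Suc r)..int (Suc r)] = - int (Suc r) # [- int r..int r] @ [int (Suc r)]"
    using upto_rec1[of "- int (Suc r)" "int (Suc r)"] upto_rec2[of "- int r" "int (Suc r)"] by simp
  then show ?thesis
    by (simp only: hd_window last_window) (simp add: window_def algebra_simps)
qed

lemma take_drop_window: "take (2 * r + 1) (drop i (window (r + i) c z)) = window r c z"
  by (rule nth_equalityI) (auto simp: nth_window algebra_simps)

lemma window_padded_rev:
  "window r (padded (rev w)) (int (length w) - 1 - z) = rev (window r (padded w) z)"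
  by (rule nth_equalityI) (auto simp: nth_window padded_rev rev_nth algebra_simps)

lemma windows_rev: "windows r (rev w) = rev ` windows r w"
proof -
  have "{0..<int (length w)} = (\<lambda>z. int (length w) - 1 - z) ` {0..<int (length w)}"
    by (auto simp: image_iff)
  then have "windows r (rev w) =
      (\<lambda>z. window r (padded (rev w)) (int (length w) - 1 - z)) ` {0..<int (length w)}"
    unfolding windows_def length_rev by (metis image_image)
  then show ?thesis by (simp add: windows_def window_padded_rev image_image)
qed

lemma windows_eq_empty_iff: "windows r w = {} \<longleftrightarrow> w = []"
  by (simp add: windows_def)

lemma window_in_windowsI:
  assumes "0 \<le> z" "z < int (length v)"
    and eq: "\<And>d. \<bar>d\<bar> \<le> int r \<Longrightarrow> padded v (z + d) = padded w (z' + d)"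
  shows "window r (padded v) z \<in> windows r w"
proof -
  have "padded w z' \<noteq> None"
    using assms(1,2) eq[of 0] by (simp add: padded_def split: if_splits)
  moreover have "window r (padded v) z = window r (padded w) z'"
    using eq by (simp add: window_eq_iff)
  ultimately show ?thesis by (auto simp: windows_def padded_eq_None_iff)
qed

lemma windows_subsetE:
  assumes "windows r v \<subseteq> windows r w" "0 \<le> z" "z < int (length v)"
  obtains n where "n < length w"
    "\<And>d. \<bar>d\<bar> \<le> int r \<Longrightarrow> padded v (z + d) = padded w (int n + d)"
proof -
  have "window r (padded v) z \<in> windows r w"
    using assms by (auto simp: windows_def)
  then obtain z' where "0 \<le> z'" "z' < int (length w)" "window r (padded v) z = window r (padded w) z'"
    by (auto simp: windows_def)
  then show thesis
    using that[of "nat z'"] by (auto simp: window_eq_iff)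
qed

section \<open>Local testability in terms of windows\<close>

definition locally_equivalent :: "nat \<Rightarrow> 'a list \<Rightarrow> 'a list \<Rightarrow> bool" where
  "locally_equivalent k v w \<longleftrightarrow>
    pref k v = pref k w \<and> infixes k v = infixes k w \<and> suff k v = suff k w"

lemma pref_eq_iff_padded_eq:
  "pref k v = pref k w \<longleftrightarrow> (\<forall>i\<in>{0..<int k}. padded v i = padded w i)"
  using take_drop_eq_iff_padded_eq[of k 0 v 0 w] by (simp add: pref_def)

lemma suff_eq_rev_pref: "suff k w = rev (pref k (rev w))"
  by (simp add: suff_def pref_def take_rev)

text \<open>If \<open>length w < k\<close>, the truncated difference makes \<open>w\<close> its only infix.\<close>

lemma infixes_eq: "infixes k w = (\<lambda>n. take k (drop n w)) ` {..length w - k}"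
proof (cases "length w \<le> k")
  case True
  then show ?thesis by (simp add: infixes_def)
next
  case False
  have "(length u = k \<and> sublist u w) \<longleftrightarrow> (\<exists>n\<le>length w - k. u = take k (drop n w))" for u
  proof
    assume "length u = k \<and> sublist u w"
    then obtain xs ys where "w = xs @ u @ ys" "length u = k"
      by (auto simp: sublist_def)
    then show "\<exists>n\<le>length w - k. u = take k (drop n w)"
      by (intro exI[of _ "length xs"]) simp
  next
    assume "\<exists>n\<le>length w - k. u = take k (drop n w)"
    then show "length u = k \<and> sublist u w"
      using False sublist_order.order.trans[OF sublist_take sublist_drop] by fastforce
  qed
  then show ?thesis using False by (auto simp: infixes_def)
qed

lemma locally_equivalent_sym: "locally_equivalent k v w \<Longrightarrow> locally_equivalent k w v"
  by (simp add: locally_equivalent_def)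

lemma window_in_windows_if_pref_eq:
  assumes "pref (2 * r + 1) v = pref (2 * r + 1) w" "0 \<le> z" "z \<le> int r" "z < int (length v)"
  shows "window r (padded v) z \<in> windows r w"
proof (rule window_in_windowsI)
  fix d assume d: "\<bar>d\<bar> \<le> int r"
  show "padded v (z + d) = padded w (z + d)"
  proof (cases "z + d < 0")
    case True
    then show ?thesis by (simp add: padded_def)
  next
    case False
    then show ?thesis using assms d by (simp add: pref_eq_iff_padded_eq)
  qed
qed (use assms in auto)

lemma window_in_windows_if_suff_eq:
  assumes "suff (2 * r + 1) v = suff (2 * r + 1) w"
    and "0 \<le> z" "int (length v) - 1 - z \<le> int r" "z < int (length v)"
  shows "window r (padded v) z \<in> windows r w"
proof -
  have "window r (padded (rev v)) (int (length v) - 1 - z) \<in> windows r (rev w)"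
    using assms by (intro window_in_windows_if_pref_eq) (auto simp: suff_eq_rev_pref)
  then show ?thesis by (auto simp: window_padded_rev windows_rev)
qed

lemma window_in_windows_if_infixes_subset:
  assumes "infixes (2 * r + 1) v \<subseteq> infixes (2 * r + 1) w" "int r \<le> z" "z + int r < int (length v)"
  shows "window r (padded v) z \<in> windows r w"
proof -
  define m where "m = nat (z - int r)"
  have z: "z = int m + int r" using assms(2) by (simp add: m_def)
  then have "take (2 * r + 1) (drop m v) \<in> infixes (2 * r + 1) v"
    using assms(3) by (auto simp: infixes_eq)
  then obtain n where "take (2 * r + 1) (drop m v) = take (2 * r + 1) (drop n w)"
    using assms(1) by (auto simp: infixes_eq)
  then have eq: "padded v (int m + i) = padded w (int n + i)" if "0 \<le> i" "i < 2 * int r + 1" for i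
    using that by (simp add: take_drop_eq_iff_padded_eq)
  show ?thesis
  proof (rule window_in_windowsI)
    fix d assume "\<bar>d\<bar> \<le> int r"
    then show "padded v (z + d) = padded w (int n + int r + d)"
      using eq[of "int r + d"] by (simp add: z add.assoc)
  qed (use assms in auto)
qed

lemma windows_eq_if_locally_equivalent:
  assumes "locally_equivalent (2 * r + 1) v w"
  shows "windows r v = windows r w"
proof -
  have "windows r v \<subseteq> windows r w" if "locally_equivalent (2 * r + 1) v w" for v w :: "'a list"
  proof
    fix u assume "u \<in> windows r v"
    then obtain z where z: "0 \<le> z" "z < int (length v)" and u: "u = window r (padded v) z"
      by (auto simp: windows_def)
    consider "z \<le> int r" | "int (length v) - 1 - z \<le> int r" | "int r \<le> z" "z + int r < int (length v)"
      by linarith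
    then show "u \<in> windows r w"
      unfolding u using that z
      by cases (simp_all add: locally_equivalent_def window_in_windows_if_pref_eq
          window_in_windows_if_suff_eq window_in_windows_if_infixes_subset)
  qed
  from this[OF assms] this[OF locally_equivalent_sym[OF assms]] show ?thesis by (rule equalityI)
qed

lemma pref_eq_if_windows_eq:
  assumes "0 < k" and eq: "windows k v = windows k w"
  shows "pref k v = pref k w"
proof (cases "v = []")
  case True
  then show ?thesis using eq windows_eq_empty_iff by metis
next
  case False
  obtain n where "n < length w"
    and agree: "\<And>d. \<bar>d\<bar> \<le> int k \<Longrightarrow> padded v (0 + d) = padded w (int n + d)"
    using windows_subsetE[OF equalityD1[OF eq], of 0] False by auto
  have "padded w (int n - 1) = None"
    using agree[of "-1"] \<open>0 < k\<close> by (simp add: padded_def)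
  then have "n = 0"
    using \<open>n < length w\<close> by (simp add: padded_eq_None_iff)
  then show ?thesis
    using agree by (simp add: pref_eq_iff_padded_eq)
qed

lemma suff_eq_if_windows_eq:
  assumes "0 < k" "windows k v = windows k w"
  shows "suff k v = suff k w"
  using pref_eq_if_windows_eq[of k "rev v" "rev w"] assms
  by (simp add: suff_eq_rev_pref windows_rev)

lemma infixes_subset_if_windows_subset:
  assumes "0 < k" "windows k v \<subseteq> windows k w" "k \<le> length v"
  shows "infixes k v \<subseteq> infixes k w"
proof
  fix u assume "u \<in> infixes k v"
  then obtain m where u: "u = take k (drop m v)" and m: "m + k \<le> length v"
    using \<open>k \<le> length v\<close> by (auto simp: infixes_eq)
  obtain n where "\<And>d. \<bar>d\<bar> \<le> int k \<Longrightarrow> padded v (int m + d) = padded w (int n + d)"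
    using windows_subsetE[OF assms(2), of "int m"] m \<open>0 < k\<close> by auto
  then have u': "u = take k (drop n w)"
    unfolding u take_drop_eq_iff_padded_eq by auto
  have "length u = k" using u m by simp
  then have "n \<le> length w - k" using u' \<open>0 < k\<close> by auto
  then show "u \<in> infixes k w" by (auto simp: infixes_eq u')
qed

lemma infixes_eq_if_windows_eq:
  assumes "0 < k" "windows k v = windows k w"
  shows "infixes k v = infixes k w"
proof (cases "length v < k \<or> length w < k")
  case True
  have take_eq: "take k v = take k w"
    using pref_eq_if_windows_eq[OF assms] by (simp add: pref_def)
  from arg_cong[OF this, of length] True have "length v < k" "length w < k"
    by (auto simp: min_def split: if_splits)
  then have "v = w" using take_eq by simp
  then show ?thesis by simp
next
  case False
  then show ?thesis
    using assms by (intro equalityI infixes_subset_if_windows_subset) auto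
qed

lemma locally_equivalent_if_windows_eq:
  assumes "0 < k" "windows k v = windows k w"
  shows "locally_equivalent k v w"
  unfolding locally_equivalent_def
  using pref_eq_if_windows_eq[OF assms] infixes_eq_if_windows_eq[OF assms] suff_eq_if_windows_eq[OF assms]
  by (intro conjI)

lemma locally_testable_iff_windows:
  "locally_testable \<Sigma> L \<longleftrightarrow> L \<subseteq> lists \<Sigma> \<and>
    (\<exists>r. \<forall>v\<in>lists \<Sigma>. \<forall>w\<in>lists \<Sigma>. windows r v = windows r w \<longrightarrow> (v \<in> L \<longleftrightarrow> w \<in> L))"
    (is "_ \<longleftrightarrow> _ \<and> (\<exists>r. ?determined r)")
proof -
  let ?tests = "\<lambda>k. \<forall>v\<in>lists \<Sigma>. \<forall>w\<in>lists \<Sigma>. locally_equivalent k v w \<longrightarrow> (v \<in> L \<longleftrightarrow> w \<in> L)"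
  have "(\<exists>k>0. ?tests k) \<longleftrightarrow> (\<exists>r. ?determined r)"
  proof
    assume "\<exists>k>0. ?tests k"
    then obtain k where "0 < k" and tests: "?tests k" by blast
    have "?determined k"
      by (intro ballI impI tests[rule_format] locally_equivalent_if_windows_eq \<open>0 < k\<close>)
    then show "\<exists>r. ?determined r" ..
  next
    assume "\<exists>r. ?determined r"
    then obtain r where determined: "?determined r" ..
    have "?tests (2 * r + 1)"
      by (intro ballI impI determined[rule_format] windows_eq_if_locally_equivalent)
    then show "\<exists>k>0. ?tests k" by (intro exI[of _ "2 * r + 1"]) simp
  qed
  then show ?thesis
    unfolding locally_testable_def locally_equivalent_def by (rule conj_cong[OF refl])
qed

section \<open>Constant-time languages are locally testable\<close>

lemma global_map_apply: "global_map C c z = rule C (c (z - 1)) (c z) (c (z + 1))"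
  by (simp add: global_map_def)

lemma config_at_0: "config_at C w 0 = initial_config C w"
  by (simp add: config_at_def)

lemma config_at_Suc:
  "config_at C w (Suc t) z =
    rule C (config_at C w t (z - 1)) (config_at C w t z) (config_at C w t (z + 1))"
  by (simp add: config_at_def global_map_apply)

lemma initial_config_eq_padded:
  "initial_config C w z = (case padded w z of None \<Rightarrow> inactive C | Some a \<Rightarrow> a)"
  by (simp add: initial_config_def padded_def)

lemma funpow_global_map_eq_if_window_eq:
  assumes "window t c z = window t c' z'"
  shows "(global_map C ^^ t) c z = (global_map C ^^ t) c' z'"
  using assms
proof (induction t arbitrary: z z')
  case 0
  then show ?case by (simp add: window_def)
next
  case (Suc t)
  have "(global_map C ^^ t) c (z + e) = (global_map C ^^ t) c' (z' + e)" if "\<bar>e\<bar> \<le> 1" for e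
  proof (rule Suc.IH)
    have "c (z + (e + d)) = c' (z' + (e + d))" if "\<bar>d\<bar> \<le> int t" for d
      using Suc.prems that \<open>\<bar>e\<bar> \<le> 1\<close> unfolding window_eq_iff by simp
    then show "window t c (z + e) = window t c' (z' + e)"
      by (simp add: window_eq_iff add.assoc)
  qed
  from this[of "-1"] this[of 0] this[of 1] show ?case
    by (simp add: global_map_apply[of C "(global_map C ^^ t) _"])
qed

lemma config_at_eq_if_window_eq:
  assumes "window r (padded v) y = window r (padded w) z" "t \<le> r"
  shows "config_at C v t y = config_at C w t z"
  unfolding config_at_def
  using assms
  by (intro funpow_global_map_eq_if_window_eq) (simp add: window_eq_iff initial_config_eq_padded)

lemma config_at_in_states:
  assumes "is_ca C" "w \<in> lists (alphabet C)"
  shows "config_at C w t z \<in> states C"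
proof (induction t arbitrary: z)
  case 0
  then show ?case
    using padded_in_cells[OF assms(2), of z] assms(1)
    by (auto simp: config_at_0 initial_config_eq_padded is_ca_def)
next
  case (Suc t)
  then show ?case using assms(1) by (simp add: config_at_Suc is_ca_def)
qed

lemma config_at_outside:
  assumes "is_ca C" "w \<in> lists (alphabet C)" "padded w z = None"
  shows "config_at C w t z = inactive C"
proof (induction t)
  case 0
  then show ?case using assms(3) by (simp add: config_at_0 initial_config_eq_padded)
next
  case (Suc t)
  then show ?case
    using config_at_in_states[OF assms(1,2)] assms(1) unfolding config_at_Suc is_ca_def by metis
qed

lemma final_config_if_windows_subset:
  assumes "is_ca C" "v \<in> lists (alphabet C)" "windows r v \<subseteq> windows r w" "t \<le> r"
    and final: "final_config C F (config_at C w t)"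
  shows "final_config C F (config_at C v t)"
  unfolding final_config_def
proof
  fix z
  show "config_at C v t z \<in> F \<union> {inactive C}"
  proof (cases "padded v z")
    case None
    then show ?thesis using config_at_outside assms(1,2) by blast
  next
    case (Some a)
    then have "window r (padded v) z \<in> windows r w"
      using assms(3) by (auto simp: windows_def padded_def split: if_splits)
    then obtain y where "window r (padded v) z = window r (padded w) y"
      by (auto simp: windows_def)
    then show ?thesis
      using config_at_eq_if_window_eq[OF _ \<open>t \<le> r\<close>] final by (metis final_config_def)
  qed
qed

abbreviation decided_at :: "('a, 'b) daca_scheme \<Rightarrow> 'a list \<Rightarrow> nat \<Rightarrow> bool" where
  "decided_at C w t \<equiv> accept_final_at C w t \<or> reject_final_at C w t"

lemma decided_at_decision_time:
  assumes "decided_at C w t"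
  shows "decided_at C w (decision_time C w)"
  unfolding decision_time_def using assms by (rule LeastI)

lemma decision_time_le: "decided_at C w t \<Longrightarrow> decision_time C w \<le> t"
  unfolding decision_time_def by (rule Least_le)

lemma accepts_iff_accept_final_at_decision_time:
  assumes "decided_at C w t"
  shows "accepts C w \<longleftrightarrow> accept_final_at C w (decision_time C w)"
  unfolding accepts_def
  using decided_at_decision_time[OF assms] decision_time_le
  by (metis le_neq_implies_less not_less)

lemma is_daca_imp_decided_at:
  assumes "is_daca C" "w \<in> nonempty_words (alphabet C)"
  obtains t where "decided_at C w t"
  using assms unfolding is_daca_def by blast

lemma decision_time_le_if_windows_subset:
  assumes C: "is_daca C" and "v \<in> nonempty_words (alphabet C)" "w \<in> nonempty_words (alphabet C)"
    and "windows r v \<subseteq> windows r w" "decision_time C w \<le> r"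
  shows "decision_time C v \<le> decision_time C w"
proof (rule decision_time_le)
  have "decided_at C w (decision_time C w)"
    using is_daca_imp_decided_at[OF C assms(3)] decided_at_decision_time by metis
  then show "decided_at C v (decision_time C w)"
    using assms final_config_if_windows_subset[of C v r w "decision_time C w"]
    by (auto simp: is_daca_def nonempty_words_def)
qed

lemma accepts_if_windows_eq:
  assumes C: "is_daca C" and words: "v \<in> nonempty_words (alphabet C)" "w \<in> nonempty_words (alphabet C)"
    and eq: "windows r v = windows r w"
    and time: "decision_time C v \<le> r" "decision_time C w \<le> r"
    and "accepts C w"
  shows "accepts C v"
proof -
  have time_eq: "decision_time C v = decision_time C w"
    using words eq time
    by (intro order_antisym decision_time_le_if_windows_subset[OF C, where r = r]) simp_all
  obtain s t where "decided_at C v s" and "decided_at C w t"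
    using is_daca_imp_decided_at[OF C] words by metis
  then have "accept_final_at C w (decision_time C w)"
    using \<open>accepts C w\<close> accepts_iff_accept_final_at_decision_time by metis
  moreover have "is_ca C" "v \<in> lists (alphabet C)"
    using C words by (auto simp: is_daca_def nonempty_words_def)
  ultimately have "accept_final_at C v (decision_time C v)"
    using final_config_if_windows_subset[OF _ _ equalityD1[OF eq]] time time_eq by simp
  then show "accepts C v"
    using accepts_iff_accept_final_at_decision_time[OF \<open>decided_at C v s\<close>] by simp
qed

lemma DACA_const_subset_LT: "DACA_const \<Sigma> \<subseteq> LT \<Sigma>"
proof
  fix L assume "L \<in> DACA_const \<Sigma>"
  then obtain b and C :: "'a daca" where L: "L = language C" and C: "is_daca C" "alphabet C = \<Sigma>"
    and time: "\<And>w. w \<in> nonempty_words \<Sigma> \<Longrightarrow> decision_time C w \<le> b"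
    by (auto simp: DACA_const_def DACA_def)
  have sub: "L \<subseteq> nonempty_words \<Sigma>"
    by (auto simp: L C(2) language_def)
  have transfer: "v \<in> L" if "v \<in> lists \<Sigma>" "windows b v = windows b w" "w \<in> L" for v w
  proof -
    have w: "w \<in> nonempty_words \<Sigma>" "accepts C w"
      using \<open>w \<in> L\<close> by (auto simp: L C(2) language_def)
    then have "windows b v \<noteq> {}"
      by (simp add: that(2) windows_eq_empty_iff nonempty_words_def)
    then have "v \<in> nonempty_words \<Sigma>"
      using that(1) by (simp add: windows_eq_empty_iff nonempty_words_def)
    moreover from this have "accepts C v"
      using accepts_if_windows_eq[OF C(1), of v w b] w that(2) time by (simp add: C(2))
    ultimately show "v \<in> L"
      by (simp add: L C(2) language_def)
  qed
  have "locally_testable \<Sigma> L"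
    unfolding locally_testable_iff_windows
  proof (intro conjI exI[of _ b] ballI impI iffI)
    show "L \<subseteq> lists \<Sigma>" using sub by (auto simp: nonempty_words_def)
  qed (metis transfer)+
  then show "L \<in> LT \<Sigma>" using sub by (simp add: LT_def)
qed

section \<open>Renaming states\<close>

definition rename_daca :: "('b \<Rightarrow> 'a) \<Rightarrow> 'b daca \<Rightarrow> 'a daca" where
  "rename_daca f C =
    (let g = inv_into (states C) f in
     \<lparr>states = f ` states C, rule = \<lambda>x y z. f (rule C (g x) (g y) (g z)),
      alphabet = f ` alphabet C, inactive = f (inactive C),
      accept_states = f ` accept_states C, reject_states = f ` reject_states C\<rparr>)"

lemma rename_daca_simps [simp]:
  "states (rename_daca f C) = f ` states C"
  "alphabet (rename_daca f C) = f ` alphabet C"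
  "inactive (rename_daca f C) = f (inactive C)"
  "accept_states (rename_daca f C) = f ` accept_states C"
  "reject_states (rename_daca f C) = f ` reject_states C"
  "rule (rename_daca f C) x y z =
    f (rule C (inv_into (states C) f x) (inv_into (states C) f y) (inv_into (states C) f z))"
  by (simp_all add: rename_daca_def Let_def)

lemma nonempty_words_image: "nonempty_words (f ` A) = map f ` nonempty_words A"
  by (auto simp: nonempty_words_def lists_image)

context
  fixes f :: "'b \<Rightarrow> 'a" and C :: "'b daca"
  assumes ca: "is_ca C" and inj: "inj_on f (states C)"
begin

lemma is_ca_rename_daca: "is_ca (rename_daca f C)"
proof -
  have "f (inactive C) \<notin> f ` alphabet C"
    using ca inj_on_image_mem_iff[OF inj, of "inactive C" "alphabet C"] by (auto simp: is_ca_def)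
  then show ?thesis
    using ca by (auto simp: is_ca_def inj inj_on_eq_iff[OF inj])
qed

lemma config_at_rename_daca:
  assumes "w \<in> lists (alphabet C)"
  shows "config_at (rename_daca f C) (map f w) t z = f (config_at C w t z)"
proof (induction t arbitrary: z)
  case 0
  show ?case
    by (simp add: config_at_0 initial_config_eq_padded padded_map split: option.split)
next
  case (Suc t)
  then show ?case
    using config_at_in_states[OF ca assms] inj by (simp add: config_at_Suc)
qed

lemma final_config_rename_daca:
  assumes w: "w \<in> lists (alphabet C)" and F: "F \<subseteq> states C"
  shows "final_config (rename_daca f C) (f ` F) (config_at (rename_daca f C) (map f w) t) \<longleftrightarrow>
    final_config C F (config_at C w t)"
proof -
  have "F \<union> {inactive C} \<subseteq> states C"
    using F ca by (auto simp: is_ca_def)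
  then have "f (config_at C w t z) \<in> f ` (F \<union> {inactive C}) \<longleftrightarrow>
      config_at C w t z \<in> F \<union> {inactive C}" for z
    by (rule inj_on_image_mem_iff[OF inj config_at_in_states[OF ca w]])
  then show ?thesis by (simp add: final_config_def config_at_rename_daca[OF w])
qed

end

context
  fixes f :: "'b \<Rightarrow> 'a" and C :: "'b daca"
  assumes C: "is_daca C" and inj: "inj_on f (states C)"
begin

lemma final_at_rename_daca:
  assumes "w \<in> nonempty_words (alphabet C)"
  shows "accept_final_at (rename_daca f C) (map f w) t \<longleftrightarrow> accept_final_at C w t"
    and "reject_final_at (rename_daca f C) (map f w) t \<longleftrightarrow> reject_final_at C w t"
proof -
  have "is_ca C" "accept_states C \<subseteq> states C" "reject_states C \<subseteq> states C"
    using C by (auto simp: is_daca_def)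
  moreover have "w \<in> lists (alphabet C)"
    using assms by (simp add: nonempty_words_def)
  ultimately show "accept_final_at (rename_daca f C) (map f w) t \<longleftrightarrow> accept_final_at C w t"
    "reject_final_at (rename_daca f C) (map f w) t \<longleftrightarrow> reject_final_at C w t"
    by (simp_all add: final_config_rename_daca[OF _ inj])
qed

lemma is_daca_rename_daca: "is_daca (rename_daca f C)"
proof -
  have image_subset: "f ` F \<subseteq> f ` states C - {f (inactive C)}" if "F \<subseteq> states C - {inactive C}" for F
  proof -
    have "inactive C \<in> states C" using C by (simp add: is_daca_def is_ca_def)
    then show ?thesis using that inj_onD[OF inj] by fastforce
  qed
  have "f ` accept_states C \<inter> f ` reject_states C = f ` (accept_states C \<inter> reject_states C)"
    using C by (intro inj_on_image_Int[OF inj, symmetric]) (auto simp: is_daca_def)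
  moreover have "\<exists>t. decided_at (rename_daca f C) w t"
    if w: "w \<in> nonempty_words (alphabet (rename_daca f C))" for w
  proof -
    obtain v where v: "w = map f v" "v \<in> nonempty_words (alphabet C)"
      using w by (auto simp: nonempty_words_image)
    then show ?thesis
      using is_daca_imp_decided_at[OF C v(2)] final_at_rename_daca[OF v(2)] by metis
  qed
  ultimately show ?thesis
    using C is_ca_rename_daca[OF _ inj] by (simp add: is_daca_def image_subset)
qed

lemma language_rename_daca: "language (rename_daca f C) = map f ` language C"
proof -
  have "accepts (rename_daca f C) (map f w) \<longleftrightarrow> accepts C w" if "w \<in> nonempty_words (alphabet C)" for w
    unfolding accepts_def final_at_rename_daca[OF that] ..
  then show ?thesis
    by (auto simp: language_def nonempty_words_image)
qed

lemma decision_time_rename_daca: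
  assumes "w \<in> nonempty_words (alphabet C)"
  shows "decision_time (rename_daca f C) (map f w) = decision_time C w"
  unfolding decision_time_def final_at_rename_daca[OF assms] ..

end

lemma inj_on_extend_left_inverse:
  fixes e :: "'a::infinite \<Rightarrow> 'b"
  assumes "finite S" "finite A" "inj_on e A"
  obtains f where "inj_on f S" "\<And>a. a \<in> A \<Longrightarrow> f (e a) = a"
proof -
  obtain B :: "'a set" where B: "A \<inter> B = {}" "finite B" "card S \<le> card B"
    using arb_finite_subset[OF \<open>finite A\<close>] by blast
  then obtain h where h: "h ` S \<subseteq> B" "inj_on h S"
    using card_le_inj[OF \<open>finite S\<close>] by blast
  define f where "f x = (if x \<in> e ` A then inv_into A e x else h x)" for x
  have "inv_into A e ` e ` A \<subseteq> A"
    by (auto intro: inv_into_into)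
  then have "inv_into A e ` e ` A \<inter> h ` S = {}"
    using h(1) B(1) by blast
  then have "inj_on f (e ` A \<union> S)"
    unfolding f_def using inj_on_disjoint_Un[OF inj_on_inv_into[OF order_refl] h(2)] by blast
  moreover have "f (e a) = a" if "a \<in> A" for a
    using that assms(3) by (simp add: f_def)
  ultimately show thesis
    using that inj_on_subset by blast
qed

lemma DACA_if_encoded:
  fixes e :: "'a::infinite \<Rightarrow> 'b" and C :: "'b daca"
  assumes "finite \<Sigma>" "inj_on e \<Sigma>" and C: "is_daca C" and alphabet: "alphabet C = e ` \<Sigma>"
    and "L \<subseteq> lists \<Sigma>" and language: "language C = map e ` L"
    and time: "\<And>w. w \<in> nonempty_words \<Sigma> \<Longrightarrow> decision_time C (map e w) \<le> t (length w)"
  shows "L \<in> DACA \<Sigma> t"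
proof -
  have "finite (states C)" using C by (simp add: is_daca_def is_ca_def)
  then obtain f where inj: "inj_on f (states C)" and f: "\<And>a. a \<in> \<Sigma> \<Longrightarrow> f (e a) = a"
    using inj_on_extend_left_inverse assms(1,2) by metis
  have map_f: "map f (map e w) = w" if "w \<in> lists \<Sigma>" for w
    using that f by (simp add: map_idI in_lists_conv_set)
  have "alphabet (rename_daca f C) = \<Sigma>"
    using f by (simp add: alphabet image_image)
  moreover have "language (rename_daca f C) = L"
  proof -
    have "language (rename_daca f C) = (\<lambda>w. map f (map e w)) ` L"
      by (simp only: language_rename_daca[OF C inj] language image_image)
    also have "\<dots> = (\<lambda>w. w) ` L"
      using map_f \<open>L \<subseteq> lists \<Sigma>\<close> by (intro image_cong) auto
    finally show ?thesis by simp
  qed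
  moreover have "decision_time (rename_daca f C) w \<le> t (length w)" if "w \<in> nonempty_words \<Sigma>" for w
  proof -
    have "map e w \<in> nonempty_words (alphabet C)"
      using that by (simp add: alphabet nonempty_words_image)
    moreover have "map f (map e w) = w"
      using map_f that by (simp add: nonempty_words_def)
    ultimately show ?thesis
      using decision_time_rename_daca[OF C inj, of "map e w"] time[OF that] by simp
  qed
  ultimately show ?thesis
    using is_daca_rename_daca[OF C inj] by (auto simp: DACA_def)
qed

section \<open>A window-collecting automaton\<close>

definition padded_factors :: "'a set \<Rightarrow> nat \<Rightarrow> 'a option list set" where
  "padded_factors \<Sigma> n = {u. set u \<subseteq> cells \<Sigma> \<and> length u = n}"

lemma finite_padded_factors: "finite \<Sigma> \<Longrightarrow> finite (padded_factors \<Sigma> n)"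
  unfolding padded_factors_def by (rule finite_lists_length_eq) simp

lemma windows_subset_padded_factors:
  "w \<in> lists \<Sigma> \<Longrightarrow> windows r w \<subseteq> padded_factors \<Sigma> (2 * r + 1)"
  unfolding windows_def padded_factors_def by (rule image_subsetI) (simp add: set_window_padded)

abbreviation encode :: "'a \<Rightarrow> 'a option list" where
  "encode a \<equiv> [Some a]"

locale window_voting =
  fixes \<Sigma> :: "'a set" and r :: nat
    and rank :: "'a option list set \<Rightarrow> nat" and \<A> :: "'a option list set set"
  assumes finite_alphabet: "finite \<Sigma>"
    and inj_on_rank: "inj_on rank (Pow (padded_factors \<Sigma> (2 * r + 1)))"
    and strict_mono_on_rank: "strict_mono_on (Pow (padded_factors \<Sigma> (2 * r + 1))) rank"
begin

abbreviation candidates :: "'a option list set set" where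
  "candidates \<equiv> Pow (padded_factors \<Sigma> (2 * r + 1))"

definition deadline :: nat where
  "deadline = r + rank (padded_factors \<Sigma> (2 * r + 1))"

definition collected :: "'a option list set" where
  "collected = {u. set u \<subseteq> cells \<Sigma> \<and> length u \<le> 2 * deadline + 1}"

definition voters :: "'a option list set set \<Rightarrow> 'a option list set" where
  "voters \<V> = {u \<in> collected - {[None]}.
    \<exists>V\<in>\<V>. length u = 2 * (r + rank V) + 1 \<and> take (2 * r + 1) (drop (rank V) u) \<in> V}"

text \<open>
  In step \<open>t\<close> an active cell stores its window of radius \<open>t\<close>, so that the length of the state
  doubles as a clock.  The states \<open>[]\<close> and \<open>[None, None]\<close> are unreachable; they keep the accept
  and reject sets nonempty.
\<close>

definition voting_daca :: "'a option list daca" where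
  "voting_daca =
     \<lparr>states = collected,
      rule = \<lambda>x y z. if y = [None] then [None]
        else if hd x # y @ [last z] \<in> collected then hd x # y @ [last z] else y,
      alphabet = encode ` \<Sigma>,
      inactive = [None],
      accept_states = insert [] (voters (candidates \<inter> \<A>)),
      reject_states = insert [None, None] (voters (candidates - \<A>))\<rparr>"

lemma voting_daca_simps [simp]:
  "states voting_daca = collected"
  "rule voting_daca x y z = (if y = [None] then [None]
    else if hd x # y @ [last z] \<in> collected then hd x # y @ [last z] else y)"
  "alphabet voting_daca = encode ` \<Sigma>"
  "inactive voting_daca = [None]"
  "accept_states voting_daca = insert [] (voters (candidates \<inter> \<A>))"
  "reject_states voting_daca = insert [None, None] (voters (candidates - \<A>))"
  by (simp_all add: voting_daca_def)

lemma finite_collected: "finite collected"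
  unfolding collected_def using finite_alphabet by (intro finite_lists_length_le) simp

lemma rank_mono:
  assumes "V \<subseteq> W" "W \<in> candidates"
  shows "rank V \<le> rank W"
proof (cases "V = W")
  case False
  then have "V \<subset> W" "V \<in> candidates" using assms by auto
  then show ?thesis
    using strict_mono_onD[OF strict_mono_on_rank _ assms(2)] by (simp add: less_imp_le)
qed simp

lemma rank_le_deadline: "V \<in> candidates \<Longrightarrow> r + rank V \<le> deadline"
  by (simp add: deadline_def rank_mono)

lemma deadline_pos: "0 < deadline"
proof -
  have "replicate (2 * r + 1) None \<in> padded_factors \<Sigma> (2 * r + 1)"
    by (auto simp: padded_factors_def)
  then have "rank {} < rank (padded_factors \<Sigma> (2 * r + 1))"
    using strict_mono_onD[OF strict_mono_on_rank] by blast
  then show ?thesis by (simp add: deadline_def)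
qed

lemma is_ca_voting_daca: "is_ca voting_daca"
  using finite_collected by (auto simp: is_ca_def) (auto simp: collected_def)

lemma window_in_collected:
  "w \<in> lists \<Sigma> \<Longrightarrow> t \<le> deadline \<Longrightarrow> window t (padded w) z \<in> collected"
  using set_window_padded by (simp add: collected_def)

lemma window_active_neq_inactive:
  assumes "padded w z \<noteq> None"
  shows "window t (padded w) z \<noteq> [None]"
proof
  assume eq: "window t (padded w) z = [None]"
  from arg_cong[OF eq, of length] have "t = 0" by simp
  then show False using eq assms by (simp add: window_def)
qed

lemma config_at_voting_daca:
  assumes w: "w \<in> lists \<Sigma>" and "t \<le> deadline"
  shows "config_at voting_daca (map encode w) t z =
    (if padded w z = None then [None] else window t (padded w) z)"
  using \<open>t \<le> deadline\<close>
proof (induction t arbitrary: z)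
  case 0
  then show ?case
    by (auto simp: config_at_0 initial_config_eq_padded padded_map window_def split: option.split)
next
  case (Suc t)
  let ?c = "config_at voting_daca (map encode w) t"
  have IH: "?c z = (if padded w z = None then [None] else window t (padded w) z)" for z
    using Suc by simp
  show ?case
  proof (cases "padded w z = None")
    case True
    then show ?thesis by (simp add: config_at_Suc IH)
  next
    case False
    have "hd (?c (z - 1)) = hd (window t (padded w) (z - 1))"
      using False by (auto simp: IH hd_window padded_def)
    moreover have "last (?c (z + 1)) = last (window t (padded w) (z + 1))"
      using False by (auto simp: IH last_window padded_def)
    ultimately have "hd (?c (z - 1)) # ?c z @ [last (?c (z + 1))] = window (Suc t) (padded w) z"
      using False by (simp add: IH window_Suc del: not_None_eq)
    then show ?thesis
      using False window_active_neq_inactive[OF False] window_in_collected[OF w Suc.prems]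
      by (simp add: config_at_Suc IH del: not_None_eq)
  qed
qed

lemma window_in_voters_iff:
  assumes "w \<in> lists \<Sigma>" "t \<le> deadline" "padded w z \<noteq> None"
  shows "window t (padded w) z \<in> voters \<V> \<longleftrightarrow>
    (\<exists>V\<in>\<V>. t = r + rank V \<and> window r (padded w) z \<in> V)"
proof -
  have "(length (window t (padded w) z) = 2 * (r + rank V) + 1 \<and>
      take (2 * r + 1) (drop (rank V) (window t (padded w) z)) \<in> V) \<longleftrightarrow>
      (t = r + rank V \<and> window r (padded w) z \<in> V)" for V
    using take_drop_window[of r "rank V" "padded w" z] by (cases "t = r + rank V") auto
  then show ?thesis
    using window_in_collected[OF assms(1,2)] window_active_neq_inactive[OF assms(3)]
    by (simp add: voters_def)
qed

lemma unanimous_vote_iff: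
  assumes w: "w \<in> nonempty_words \<Sigma>" and \<V>: "\<V> \<subseteq> candidates"
  shows "(\<forall>u\<in>windows r w. \<exists>V\<in>\<V>. t = r + rank V \<and> u \<in> V) \<longleftrightarrow>
    (\<exists>V\<in>\<V>. t = r + rank V \<and> windows r w \<subseteq> V)"
proof
  assume each: "\<forall>u\<in>windows r w. \<exists>V\<in>\<V>. t = r + rank V \<and> u \<in> V"
  have "windows r w \<noteq> {}"
    using w by (simp add: windows_eq_empty_iff nonempty_words_def)
  then obtain V where V: "V \<in> \<V>" "t = r + rank V"
    using each by blast
  have "V' = V" if "V' \<in> \<V>" "t = r + rank V'" for V'
    using inj_onD[OF inj_on_rank] that V \<V> by auto
  then show "\<exists>V\<in>\<V>. t = r + rank V \<and> windows r w \<subseteq> V"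
    using each V by blast
qed blast

lemma final_config_voting_daca_iff:
  assumes w: "w \<in> nonempty_words \<Sigma>" and t: "t \<le> deadline"
    and \<V>: "\<V> \<subseteq> candidates" and junk: "even (length u)"
  shows "final_config voting_daca (insert u (voters \<V>))
      (config_at voting_daca (map encode w) t) \<longleftrightarrow>
    (\<exists>V\<in>\<V>. t = r + rank V \<and> windows r w \<subseteq> V)"
proof -
  have lists: "w \<in> lists \<Sigma>"
    using w by (simp add: nonempty_words_def)
  have "config_at voting_daca (map encode w) t z \<in> insert u (voters \<V>) \<union> {[None]} \<longleftrightarrow>
      (padded w z \<noteq> None \<longrightarrow> window t (padded w) z \<in> voters \<V>)" for z
  proof -
    have "window t (padded w) z \<noteq> u"
      using junk length_window[of t "padded w" z] by auto
    then show ?thesis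
      using window_active_neq_inactive[of w z t]
      by (cases "padded w z = None") (simp_all add: config_at_voting_daca[OF lists t] del: not_None_eq)
  qed
  then have "final_config voting_daca (insert u (voters \<V>))
      (config_at voting_daca (map encode w) t) \<longleftrightarrow>
      (\<forall>z. padded w z \<noteq> None \<longrightarrow> window t (padded w) z \<in> voters \<V>)"
    by (simp add: final_config_def)
  also have "\<dots> \<longleftrightarrow>
      (\<forall>z. padded w z \<noteq> None \<longrightarrow> (\<exists>V\<in>\<V>. t = r + rank V \<and> window r (padded w) z \<in> V))"
    using window_in_voters_iff[OF lists t] by simp
  also have "\<dots> \<longleftrightarrow> (\<forall>u\<in>windows r w. \<exists>V\<in>\<V>. t = r + rank V \<and> u \<in> V)"
    by (auto simp: windows_def padded_eq_None_iff)
  also have "\<dots> \<longleftrightarrow> (\<exists>V\<in>\<V>. t = r + rank V \<and> windows r w \<subseteq> V)"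
    using w \<V> by (rule unanimous_vote_iff)
  finally show ?thesis .
qed

lemma windows_in_candidates: "w \<in> nonempty_words \<Sigma> \<Longrightarrow> windows r w \<in> candidates"
  using windows_subset_padded_factors[of w \<Sigma> r] by (simp add: nonempty_words_def)

lemma final_at_voting_daca_iff:
  assumes "w \<in> nonempty_words \<Sigma>" "t \<le> deadline"
  shows "accept_final_at voting_daca (map encode w) t \<longleftrightarrow>
      (\<exists>V\<in>candidates \<inter> \<A>. t = r + rank V \<and> windows r w \<subseteq> V)"
    and "reject_final_at voting_daca (map encode w) t \<longleftrightarrow>
      (\<exists>V\<in>candidates - \<A>. t = r + rank V \<and> windows r w \<subseteq> V)"
  unfolding voting_daca_simps using assms by (intro final_config_voting_daca_iff; simp)+

lemma decided_at_voting_daca_iff: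
  assumes "w \<in> nonempty_words \<Sigma>" "t \<le> deadline"
  shows "decided_at voting_daca (map encode w) t \<longleftrightarrow>
    (\<exists>V\<in>candidates. t = r + rank V \<and> windows r w \<subseteq> V)"
  unfolding final_at_voting_daca_iff[OF assms] by blast

lemma decided_at_rank_windows:
  assumes "w \<in> nonempty_words \<Sigma>"
  shows "decided_at voting_daca (map encode w) (r + rank (windows r w))"
  using windows_in_candidates[OF assms] rank_le_deadline
  by (subst decided_at_voting_daca_iff[OF assms]) auto

lemma decision_time_voting_daca:
  assumes w: "w \<in> nonempty_words \<Sigma>"
  shows "decision_time voting_daca (map encode w) = r + rank (windows r w)"
  unfolding decision_time_def
proof (rule Least_equality)
  show "decided_at voting_daca (map encode w) (r + rank (windows r w))"
    by (rule decided_at_rank_windows[OF w])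
next
  fix t assume decided: "decided_at voting_daca (map encode w) t"
  show "r + rank (windows r w) \<le> t"
  proof (cases "t \<le> deadline")
    case True
    then obtain V where "V \<in> candidates" "t = r + rank V" "windows r w \<subseteq> V"
      using decided decided_at_voting_daca_iff[OF w] by blast
    then show ?thesis
      using rank_mono by simp
  next
    case False
    then show ?thesis
      using rank_le_deadline[OF windows_in_candidates[OF w]] by simp
  qed
qed

lemma accepts_voting_daca_iff:
  assumes w: "w \<in> nonempty_words \<Sigma>"
  shows "accepts voting_daca (map encode w) \<longleftrightarrow> windows r w \<in> \<A>"
proof -
  have candidate: "windows r w \<in> candidates"
    using w by (rule windows_in_candidates)
  have "accepts voting_daca (map encode w) \<longleftrightarrow>
      accept_final_at voting_daca (map encode w) (r + rank (windows r w))"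
    using accepts_iff_accept_final_at_decision_time[OF decided_at_rank_windows[OF w]]
    by (simp only: decision_time_voting_daca[OF w])
  also have "\<dots> \<longleftrightarrow>
      (\<exists>V\<in>candidates \<inter> \<A>. r + rank (windows r w) = r + rank V \<and> windows r w \<subseteq> V)"
    using w rank_le_deadline[OF candidate] by (rule final_at_voting_daca_iff)
  also have "\<dots> \<longleftrightarrow> windows r w \<in> \<A>"
    using candidate inj_onD[OF inj_on_rank] by auto
  finally show ?thesis .
qed

lemma voters_disjoint:
  assumes "\<V> \<subseteq> candidates" "\<W> \<subseteq> candidates" "\<V> \<inter> \<W> = {}"
  shows "voters \<V> \<inter> voters \<W> = {}"
proof -
  have "V = W" if "V \<in> \<V>" "W \<in> \<W>" "rank V = rank W" for V W
    using inj_onD[OF inj_on_rank] that assms(1,2) by blast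
  then show ?thesis using assms(3) by (fastforce simp: voters_def)
qed

lemma odd_length_voters: "u \<in> voters \<V> \<Longrightarrow> odd (length u)"
  by (auto simp: voters_def)

lemma is_daca_voting_daca: "is_daca voting_daca"
proof -
  have "voters (candidates \<inter> \<A>) \<inter> voters (candidates - \<A>) = {}"
    by (rule voters_disjoint) auto
  then have "accept_states voting_daca \<inter> reject_states voting_daca = {}"
    using odd_length_voters by fastforce
  moreover have "accept_states voting_daca \<subseteq> states voting_daca - {inactive voting_daca}"
    "reject_states voting_daca \<subseteq> states voting_daca - {inactive voting_daca}"
    using deadline_pos by (auto simp: voters_def collected_def)
  moreover have "\<exists>t. decided_at voting_daca v t" if v: "v \<in> nonempty_words (alphabet voting_daca)" for v
  proof -
    obtain w where "v = map encode w" "w \<in> nonempty_words \<Sigma>"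
      using v by (auto simp: nonempty_words_image)
    then show ?thesis using decided_at_rank_windows by blast
  qed
  ultimately show ?thesis
    using is_ca_voting_daca by (simp add: is_daca_def)
qed

lemma language_voting_daca:
  "language voting_daca = map encode ` {w \<in> nonempty_words \<Sigma>. windows r w \<in> \<A>}"
  using accepts_voting_daca_iff by (auto simp: language_def nonempty_words_image)

end

section \<open>Locally testable languages are decided in constant time\<close>

lemma inj_strict_mono_on_PowE:
  fixes U :: "'a set"
  assumes "finite U"
  obtains rank :: "'a set \<Rightarrow> nat" where "inj_on rank (Pow U)" "strict_mono_on (Pow U) rank"
proof -
  obtain e :: "'a \<Rightarrow> nat" where e: "inj_on e U"
    using finite_imp_inj_to_nat_seg[OF assms] by blast
  define rank where "rank V = set_encode (e ` V)" for V
  have finite_image: "finite (e ` V)" if "V \<subseteq> U" for V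
    using that assms finite_subset by blast
  have "inj_on rank (Pow U)"
  proof (rule inj_onI)
    fix V W assume "V \<in> Pow U" "W \<in> Pow U" "rank V = rank W"
    then have "e ` V = e ` W"
      using finite_image by (simp add: rank_def set_encode_eq)
    then show "V = W"
      using inj_on_image_eq_iff[OF e] \<open>V \<in> Pow U\<close> \<open>W \<in> Pow U\<close> by blast
  qed
  moreover have "strict_mono_on (Pow U) rank"
  proof (rule strict_mono_onI)
    fix V W assume "V \<in> Pow U" "W \<in> Pow U" "V \<subset> W"
    then have "e ` V \<subset> e ` W"
      by (intro image_strict_mono inj_on_subset[OF e]) auto
    then obtain n where "n \<in> e ` W - e ` V" by blast
    then show "rank V < rank W"
      unfolding rank_def set_encode_def
      using sum_strict_mono2[of "e ` W" "e ` V" n "(^) (2 :: nat)"] finite_image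
        \<open>V \<subset> W\<close> \<open>W \<in> Pow U\<close> by auto
  qed
  ultimately show thesis by (rule that)
qed

lemma LT_subset_DACA_const:
  fixes \<Sigma> :: "'a::infinite set"
  assumes fin: "finite \<Sigma>"
  shows "LT \<Sigma> \<subseteq> DACA_const \<Sigma>"
proof
  fix L assume "L \<in> LT \<Sigma>"
  then obtain r where L: "L \<subseteq> nonempty_words \<Sigma>"
    and determined: "\<And>v w. \<lbrakk>v \<in> lists \<Sigma>; w \<in> lists \<Sigma>; windows r v = windows r w\<rbrakk> \<Longrightarrow> v \<in> L \<longleftrightarrow> w \<in> L"
    unfolding LT_def locally_testable_iff_windows by blast
  have lists: "nonempty_words \<Sigma> \<subseteq> lists \<Sigma>"
    by (auto simp: nonempty_words_def)
  obtain rank :: "'a option list set \<Rightarrow> nat"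
    where inj: "inj_on rank (Pow (padded_factors \<Sigma> (2 * r + 1)))"
    and mono: "strict_mono_on (Pow (padded_factors \<Sigma> (2 * r + 1))) rank"
    by (rule inj_strict_mono_on_PowE[OF finite_padded_factors[OF fin]])
  interpret window_voting \<Sigma> r rank "windows r ` L"
    by (rule window_voting.intro[OF fin inj mono])
  have "windows r w \<in> windows r ` L \<longleftrightarrow> w \<in> L" if w: "w \<in> nonempty_words \<Sigma>" for w
  proof
    assume "windows r w \<in> windows r ` L"
    then obtain v where "v \<in> L" "windows r w = windows r v" ..
    then show "w \<in> L" using determined[of w v] w L lists by blast
  qed simp
  then have "language voting_daca = map encode ` L"
    using L by (auto simp: language_voting_daca)
  moreover have "decision_time voting_daca (map encode w) \<le> deadline"
    if "w \<in> nonempty_words \<Sigma>" for w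
    using rank_le_deadline[OF windows_in_candidates[OF that]]
    by (simp add: decision_time_voting_daca[OF that])
  moreover have "inj_on encode \<Sigma>" "alphabet voting_daca = encode ` \<Sigma>" "L \<subseteq> lists \<Sigma>"
    using L lists by (simp_all add: inj_on_def)
  ultimately have "L \<in> DACA \<Sigma> (\<lambda>_. deadline)"
    using DACA_if_encoded[OF fin _ is_daca_voting_daca, of encode L "\<lambda>_. deadline"] by simp
  then show "L \<in> DACA_const \<Sigma>" by (auto simp: DACA_const_def)
qed

theorem theorem8:
  fixes \<Sigma> :: "'a::infinite set"
  assumes "finite \<Sigma>"
  shows "DACA_const \<Sigma> = LT \<Sigma>"
  using DACA_const_subset_LT LT_subset_DACA_const[OF assms] by (rule equalityI)

end
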